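(* There is a specification $(\Pi^{\rm F},\Pi^{\rm G},\Delta)$ such that $\Pi^{\rm F}\cup\Pi^{\rm G}\cup\Delta$ is non-contradictory, but none of the six relations $\lesssim_{\rm P1}$, $\lesssim_{\rm P2}$, $\lesssim_{\rm P3}$, $<_{\rm P1}$, $<_{\rm P2}$, $<_{\rm P3}$ (on the arguments of this specification) is transitive. Moreover, all counterexamples to transitivity can be restricted to arguments with minimal sets of ground instances of defeasible rules; that is, for each of these six relations $R$ there are arguments $X_1,X_2,X_3$ with $X_1\,R\,X_2$ and $X_2\,R\,X_3$ but not $X_1\,R\,X_3$, where each $X_i=(\mathcal A_i,L_i)$ is such that $(\mathcal A',L_i)$ is not an argument for any proper subset $\mathcal A'\subset\mathcal A_i$.
   Context: Logic programming setting. A literal is a first-order atom, possibly prefixed with the negation symbol $\neg$. A rule is either a literal (an unconditional rule) or an expression $L\Leftarrow L_1\wedge\dots\wedge L_n$ with $n\ge 1$ and $L,L_1,\dots,L_n$ literals. Instances are obtained by substituting terms for variables; ground means without free variables. For a set of rules $\Gamma$, the theory $\mathfrak T_\Gamma$ is the smallest set of literals that contains all instances of literals from $\Gamma$ and contains every literal $L$ for which there is an instance $L\Leftarrow L_1\wedge\dots\wedge L_n$ of a rule in $\Gamma$ with $L_1,\dots,L_n\in\mathfrak T_\Gamma$. $\Gamma$ is contradictory if there is an atom $A$ with $A,\neg A\in\mathfrak T_\Gamma$; otherwise it is non-contradictory. A specification $(\Pi^{\rm F},\Pi^{\rm G},\Delta)$ consists of a set $\Pi^{\rm F}$ of literals (facts),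 a set $\Pi^{\rm G}$ of rules (general strict rules), and a set $\Delta$ of rules (defeasible rules). Set $\Pi:=\Pi^{\rm F}\cup\Pi^{\rm G}$. All notions below are relative to a specification. An argument is a pair $(\mathcal A,L)$ where $\mathcal A$ is a set of ground instances of rules from $\Delta$, $L$ is a literal, and $L\in\mathfrak T_{\mathcal A\cup\Pi}$. For a set $\mathcal A$ of ground instances of rules from $\Delta$ and a literal $L$, a set $H$ of literals is a simplified activation set for $(\mathcal A,L)$ if $L\in\mathfrak T_{H\cup\mathcal A\cup\Pi^{\rm G}}$. For arguments $(\mathcal A_1,L_1)$, $(\mathcal A_2,L_2)$: - $(\mathcal A_1,L_1)\lesssim_{\rm P1}(\mathcal A_2,L_2)$ if every $H\subseteq\mathfrak T_{\Pi\cup\Delta}$ that is a simplified activation set for $(\mathcal A_1,L_1)$ but not for $(\mathcal A_2,L_1)$ is also a simplified activation set for $(\mathcal A_2,L_2)$. - $(\mathcal A_1,L_1)\lesssim_{\rm P2}(\mathcal A_2,L_2)$ if every $H\subseteq\mathfrak T_{\Pi\cup\Delta}$ that is a simplified activation set for $(\mathcal A_1,L_1)$ but not for $(\emptyset,L_1)$ is also a simplified activation set for $(\mathcal A_2,L_2)$. - $(\mathcal A_1,L_1)\lesssim_{\rm P3}(\mathcal A_2,L_2)$ if $L_2\in\mathfrak T_\Pi$ implies $L_1\in\mathfrak T_\Pi$, and $(\mathcal A_1,L_1)\lesssim_{\rm P2}(\mathcal A_2,L_2)$. For $N\in\{{\rm P1},{\rm P2},{\rm P3}\}$, $X<_N Y$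 means: $X\lesssim_N Y$ and not $Y\lesssim_N X$. *)

theory Defs
  imports Main
begin

text \<open>
  First-order syntax over symbols \<open>'p\<close> (predicates), \<open>'f\<close> (functions) and \<open>'v\<close> (variables).
  No arity function is fixed: a symbol is identified by its name together with the number of
  arguments it is applied to.
\<close>

datatype ('f, 'v) trm = Var 'v | Fun 'f "('f, 'v) trm list"

datatype ('p, 'f, 'v) atm = Atm 'p "('f, 'v) trm list"

datatype ('p, 'f, 'v) lit = Pos "('p, 'f, 'v) atm" | Neg "('p, 'f, 'v) atm"

text \<open>
  \<open>Rule L [L\<^sub>1, \<dots>, L\<^sub>n]\<close> stands for the rule with head \<open>L\<close> and body
  \<open>L\<^sub>1 \<and> \<dots> \<and> L\<^sub>n\<close>; the unconditional rule given by a literal \<open>L\<close> is \<open>Rule L []\<close>.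
\<close>

datatype ('p, 'f, 'v) rule = Rule "('p, 'f, 'v) lit" "('p, 'f, 'v) lit list"

definition lit_rules :: "('p, 'f, 'v) lit set \<Rightarrow> ('p, 'f, 'v) rule set" where
  "lit_rules H = (\<lambda>L. Rule L []) ` H"

primrec subst_trm :: "('v \<Rightarrow> ('f, 'v) trm) \<Rightarrow> ('f, 'v) trm \<Rightarrow> ('f, 'v) trm" where
  "subst_trm \<sigma> (Var x) = \<sigma> x"
| "subst_trm \<sigma> (Fun f ts) = Fun f (map (subst_trm \<sigma>) ts)"

primrec subst_atm :: "('v \<Rightarrow> ('f, 'v) trm) \<Rightarrow> ('p, 'f, 'v) atm \<Rightarrow> ('p, 'f, 'v) atm" where
  "subst_atm \<sigma> (Atm p ts) = Atm p (map (subst_trm \<sigma>) ts)"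

primrec subst_lit :: "('v \<Rightarrow> ('f, 'v) trm) \<Rightarrow> ('p, 'f, 'v) lit \<Rightarrow> ('p, 'f, 'v) lit" where
  "subst_lit \<sigma> (Pos A) = Pos (subst_atm \<sigma> A)"
| "subst_lit \<sigma> (Neg A) = Neg (subst_atm \<sigma> A)"

primrec subst_rule :: "('v \<Rightarrow> ('f, 'v) trm) \<Rightarrow> ('p, 'f, 'v) rule \<Rightarrow> ('p, 'f, 'v) rule" where
  "subst_rule \<sigma> (Rule L Ls) = Rule (subst_lit \<sigma> L) (map (subst_lit \<sigma>) Ls)"

primrec vars_trm :: "('f, 'v) trm \<Rightarrow> 'v set" where
  "vars_trm (Var x) = {x}"
| "vars_trm (Fun f ts) = \<Union> (set (map vars_trm ts))"

primrec vars_atm :: "('p, 'f, 'v) atm \<Rightarrow> 'v set" where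
  "vars_atm (Atm p ts) = \<Union> (set (map vars_trm ts))"

primrec vars_lit :: "('p, 'f, 'v) lit \<Rightarrow> 'v set" where
  "vars_lit (Pos A) = vars_atm A"
| "vars_lit (Neg A) = vars_atm A"

primrec vars_rule :: "('p, 'f, 'v) rule \<Rightarrow> 'v set" where
  "vars_rule (Rule L Ls) = vars_lit L \<union> \<Union> (set (map vars_lit Ls))"

definition instances :: "('p, 'f, 'v) rule set \<Rightarrow> ('p, 'f, 'v) rule set" where
  "instances \<Gamma> = {subst_rule \<sigma> r | \<sigma> r. r \<in> \<Gamma>}"

definition ground_instances :: "('p, 'f, 'v) rule set \<Rightarrow> ('p, 'f, 'v) rule set" where
  "ground_instances \<Gamma> = {r \<in> instances \<Gamma>. vars_rule r = {}}"

text \<open>The case \<open>Ls = []\<close> yields all instances of the literals in \<open>\<Gamma>\<close>.\<close>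

inductive_set Th :: "('p, 'f, 'v) rule set \<Rightarrow> ('p, 'f, 'v) lit set"
  for \<Gamma> :: "('p, 'f, 'v) rule set" where
  "Rule L Ls \<in> instances \<Gamma> \<Longrightarrow> (\<forall>M \<in> set Ls. M \<in> Th \<Gamma>) \<Longrightarrow> L \<in> Th \<Gamma>"

definition contradictory :: "('p, 'f, 'v) rule set \<Rightarrow> bool" where
  "contradictory \<Gamma> \<longleftrightarrow> (\<exists>A. Pos A \<in> Th \<Gamma> \<and> Neg A \<in> Th \<Gamma>)"

record ('p, 'f, 'v) lp_spec =
  facts :: "('p, 'f, 'v) lit set"
  general :: "('p, 'f, 'v) rule set"
  defeasible :: "('p, 'f, 'v) rule set"

definition strict_part :: "('p, 'f, 'v) lp_spec \<Rightarrow> ('p, 'f, 'v) rule set" where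
  "strict_part S = lit_rules (facts S) \<union> general S"

type_synonym ('p, 'f, 'v) arg = "('p, 'f, 'v) rule set \<times> ('p, 'f, 'v) lit"

definition arguments :: "('p, 'f, 'v) lp_spec \<Rightarrow> ('p, 'f, 'v) arg set" where
  "arguments S = {(\<A>, L). \<A> \<subseteq> ground_instances (defeasible S) \<and> L \<in> Th (\<A> \<union> strict_part S)}"

definition minimal_arguments :: "('p, 'f, 'v) lp_spec \<Rightarrow> ('p, 'f, 'v) arg set" where
  "minimal_arguments S =
     {(\<A>, L). (\<A>, L) \<in> arguments S \<and> (\<forall>\<A>'. \<A>' \<subset> \<A> \<longrightarrow> (\<A>', L) \<notin> arguments S)}"

definition simplified_activation_set ::
  "('p, 'f, 'v) lp_spec \<Rightarrow> ('p, 'f, 'v) arg \<Rightarrow> ('p, 'f, 'v) lit set \<Rightarrow> bool" where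
  "simplified_activation_set S X H \<longleftrightarrow> snd X \<in> Th (lit_rules H \<union> fst X \<union> general S)"

text \<open>
  The relations below are meaningful for \<open>X, Y \<in> arguments S\<close>; this is not built into the
  definitions, so properties such as transitivity are to be taken on \<open>arguments S\<close>.
\<close>

definition P1_le ::
  "('p, 'f, 'v) lp_spec \<Rightarrow> ('p, 'f, 'v) arg \<Rightarrow> ('p, 'f, 'v) arg \<Rightarrow> bool" where
  "P1_le S X Y \<longleftrightarrow>
     (\<forall>H \<subseteq> Th (strict_part S \<union> defeasible S).
        simplified_activation_set S X H \<and> \<not> simplified_activation_set S (fst Y, snd X) H
        \<longrightarrow> simplified_activation_set S Y H)"

definition P2_le ::
  "('p, 'f, 'v) lp_spec \<Rightarrow> ('p, 'f, 'v) arg \<Rightarrow> ('p, 'f, 'v) arg \<Rightarrow> bool" where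
  "P2_le S X Y \<longleftrightarrow>
     (\<forall>H \<subseteq> Th (strict_part S \<union> defeasible S).
        simplified_activation_set S X H \<and> \<not> simplified_activation_set S ({}, snd X) H
        \<longrightarrow> simplified_activation_set S Y H)"

definition P3_le ::
  "('p, 'f, 'v) lp_spec \<Rightarrow> ('p, 'f, 'v) arg \<Rightarrow> ('p, 'f, 'v) arg \<Rightarrow> bool" where
  "P3_le S X Y \<longleftrightarrow>
     (snd Y \<in> Th (strict_part S) \<longrightarrow> snd X \<in> Th (strict_part S)) \<and> P2_le S X Y"

definition strict_of :: "('a \<Rightarrow> 'a \<Rightarrow> bool) \<Rightarrow> 'a \<Rightarrow> 'a \<Rightarrow> bool" where
  "strict_of R X Y \<longleftrightarrow> R X Y \<and> \<not> R Y X"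

end

theory Submission
  imports Defs
begin

text \<open>
  The specification is propositional. Its only fact is \<open>d\<close>, its general rules are
  \<open>d \<rightarrow> b\<close>, \<open>b \<rightarrow> c\<close>, \<open>a \<rightarrow> q\<close>, and the three arguments are
  \<open>X\<^sub>1 = ({d \<Rightarrow> a, a \<Rightarrow> p}, p)\<close>, \<open>X\<^sub>2 = ({b \<Rightarrow> q}, q)\<close>, \<open>X\<^sub>3 = ({c \<Rightarrow> r}, r)\<close>.
  The set \<open>{a}\<close> activates \<open>X\<^sub>1\<close> and also \<open>X\<^sub>2\<close>, but the latter through a general rule
  alone, so that it does not count in the comparison of \<open>X\<^sub>2\<close> with \<open>X\<^sub>3\<close>. It does not
  activate \<open>X\<^sub>3\<close>. The detour over \<open>d \<Rightarrow> a\<close> keeps \<open>q\<close> from being strictly derivable,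
  which would make \<open>X\<^sub>2\<close> non-minimal. The sets \<open>{b}\<close> and \<open>{c}\<close> witness that the
  comparisons are strict. One triple serves all six relations, because \<open>\<lesssim>\<^sub>P\<^sub>3\<close> implies
  \<open>\<lesssim>\<^sub>P\<^sub>2\<close>, which implies \<open>\<lesssim>\<^sub>P\<^sub>1\<close>.
\<close>

section \<open>Substitutions, instances and theories of ground rule sets\<close>

lemma subst_trm_ground: "vars_trm t = {} \<Longrightarrow> subst_trm \<sigma> t = t"
  by (induction t) (simp_all add: map_idI)

lemma subst_atm_ground: "vars_atm A = {} \<Longrightarrow> subst_atm \<sigma> A = A"
  by (cases A) (simp add: map_idI subst_trm_ground)

lemma subst_lit_ground: "vars_lit L = {} \<Longrightarrow> subst_lit \<sigma> L = L"
  by (cases L) (simp_all add: subst_atm_ground)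

lemma subst_rule_ground: "vars_rule r = {} \<Longrightarrow> subst_rule \<sigma> r = r"
  by (cases r) (simp add: map_idI subst_lit_ground)

lemma subst_trm_Var: "subst_trm Var t = t"
  by (induction t) (simp_all add: map_idI)

lemma subst_atm_Var: "subst_atm Var A = A"
  by (cases A) (simp add: map_idI subst_trm_Var)

lemma subst_lit_Var: "subst_lit Var L = L"
  by (cases L) (simp_all add: subst_atm_Var)

lemma subst_rule_Var: "subst_rule Var r = r"
  by (cases r) (simp add: map_idI subst_lit_Var)

lemma subset_instances: "\<Gamma> \<subseteq> instances \<Gamma>"
proof
  fix r assume "r \<in> \<Gamma>"
  then have "subst_rule Var r \<in> instances \<Gamma>"
    unfolding instances_def by blast
  then show "r \<in> instances \<Gamma>"
    by (simp add: subst_rule_Var)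
qed

lemma instances_ground:
  assumes "\<And>r. r \<in> \<Gamma> \<Longrightarrow> vars_rule r = {}"
  shows "instances \<Gamma> = \<Gamma>"
proof
  show "instances \<Gamma> \<subseteq> \<Gamma>"
    using assms by (auto simp: instances_def subst_rule_ground)
qed (rule subset_instances)

text \<open>Ground rules are their own only instances, so rule induction needs closure under the
  rules themselves. Underivability is shown below by exhibiting a closed \<open>M\<close> that omits
  the literal.\<close>

lemma Th_ground_subset:
  assumes ground: "\<And>r. r \<in> \<Gamma> \<Longrightarrow> vars_rule r = {}"
    and closed: "\<And>L Ls. Rule L Ls \<in> \<Gamma> \<Longrightarrow> set Ls \<subseteq> M \<Longrightarrow> L \<in> M"
  shows "Th \<Gamma> \<subseteq> M"
proof
  fix L assume "L \<in> Th \<Gamma>"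
  then show "L \<in> M"
    by induction (use closed in \<open>auto simp: instances_ground[OF ground]\<close>)
qed

lemma Th_rule: "Rule L Ls \<in> \<Gamma> \<Longrightarrow> set Ls \<subseteq> Th \<Gamma> \<Longrightarrow> L \<in> Th \<Gamma>"
  using Th.intros subset_instances by blast

lemma Th_mono:
  assumes "\<Gamma> \<subseteq> \<Gamma>'"
  shows "Th \<Gamma> \<subseteq> Th \<Gamma>'"
proof
  have sub: "instances \<Gamma> \<subseteq> instances \<Gamma>'"
    using assms by (auto simp: instances_def)
  fix L assume "L \<in> Th \<Gamma>"
  then show "L \<in> Th \<Gamma>'"
    by induction (use sub in \<open>auto intro: Th.intros\<close>)
qed

text \<open>Whatever activates \<open>({}, snd X)\<close> activates \<open>(fst Y, snd X)\<close> by
  monotonicity, so the P1 condition tests fewer sets \<open>H\<close>.\<close>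

lemma P2_le_imp_P1_le:
  assumes "P2_le S X Y"
  shows "P1_le S X Y"
  unfolding P1_le_def
proof (intro allI impI, elim conjE)
  fix H
  assume H: "H \<subseteq> Th (strict_part S \<union> defeasible S)" "simplified_activation_set S X H"
    and "\<not> simplified_activation_set S (fst Y, snd X) H"
  moreover have "Th (lit_rules H \<union> {} \<union> general S) \<subseteq> Th (lit_rules H \<union> fst Y \<union> general S)"
    by (rule Th_mono) auto
  ultimately have "\<not> simplified_activation_set S ({}, snd X) H"
    unfolding simplified_activation_set_def fst_conv snd_conv by blast
  with assms H show "simplified_activation_set S Y H"
    unfolding P2_le_def by blast
qed

section \<open>The propositional specification and its theories\<close>

definition plit :: "string \<Rightarrow> (string, string, string) lit" where
  "plit s = Pos (Atm s [])"

lemma vars_lit_plit [simp]: "vars_lit (plit s) = {}"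
  by (simp add: plit_def)

lemma plit_eq_iff [simp]: "plit s = plit t \<longleftrightarrow> s = t"
  by (simp add: plit_def)

definition ex_general :: "(string, string, string) rule set" where
  "ex_general =
     {Rule (plit ''b'') [plit ''d''], Rule (plit ''c'') [plit ''b''], Rule (plit ''q'') [plit ''a'']}"

definition ex_A1 :: "(string, string, string) rule set" where
  "ex_A1 = {Rule (plit ''a'') [plit ''d''], Rule (plit ''p'') [plit ''a'']}"

definition ex_A2 :: "(string, string, string) rule set" where
  "ex_A2 = {Rule (plit ''q'') [plit ''b'']}"

definition ex_A3 :: "(string, string, string) rule set" where
  "ex_A3 = {Rule (plit ''r'') [plit ''c'']}"

definition ex_spec :: "(string, string, string) lp_spec" where
  "ex_spec =
     \<lparr>facts = {plit ''d''}, general = ex_general, defeasible = ex_A1 \<union> ex_A2 \<union> ex_A3\<rparr>"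

lemmas ex_rules_defs = ex_general_def ex_A1_def ex_A2_def ex_A3_def lit_rules_def

lemma ex_strict_part: "strict_part ex_spec = lit_rules {plit ''d''} \<union> ex_general"
  by (simp add: strict_part_def ex_spec_def)

lemma ex_general [simp]: "general ex_spec = ex_general"
  by (simp add: ex_spec_def)

text \<open>All heads are positive, and this is what rules out a contradiction.\<close>

lemma ex_Th_all: "Th (strict_part ex_spec \<union> defeasible ex_spec) \<subseteq> range plit"
  unfolding ex_strict_part
  by (rule Th_ground_subset) (auto simp: ex_spec_def ex_rules_defs)

lemma ex_ground_instances: "ground_instances (defeasible ex_spec) = ex_A1 \<union> ex_A2 \<union> ex_A3"
proof -
  have "vars_rule r = {}" if "r \<in> defeasible ex_spec" for r
    using that by (auto simp: ex_spec_def ex_rules_defs)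
  then have "ground_instances (defeasible ex_spec) = defeasible ex_spec"
    by (auto simp: ground_instances_def instances_ground)
  then show ?thesis
    by (simp add: ex_spec_def)
qed

lemma ex_not_contradictory:
  "\<not> contradictory (lit_rules (facts ex_spec) \<union> general ex_spec \<union> defeasible ex_spec)"
  using ex_Th_all by (auto simp: contradictory_def strict_part_def plit_def)

text \<open>In particular \<open>q\<close> and \<open>r\<close> are not strictly derivable, which
  gives minimality of the one-rule arguments and makes the extra P3 condition vacuous.\<close>

lemma ex_Th_strict_part: "Th (strict_part ex_spec) \<subseteq> plit ` {''b'', ''c'', ''d''}"
  unfolding ex_strict_part
  by (rule Th_ground_subset) (auto simp: ex_rules_defs)

lemma ex_strict_derivable:
  assumes "strict_part ex_spec \<subseteq> \<Gamma>"
  shows "plit ''b'' \<in> Th \<Gamma>" "plit ''c'' \<in> Th \<Gamma>" "plit ''d'' \<in> Th \<Gamma>"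
proof -
  show d: "plit ''d'' \<in> Th \<Gamma>"
    by (rule Th_rule[where Ls = "[]"])
      (use assms in \<open>auto simp: ex_strict_part ex_rules_defs\<close>)
  show b: "plit ''b'' \<in> Th \<Gamma>"
    by (rule Th_rule[where Ls = "[plit ''d'']"])
      (use assms d in \<open>auto simp: ex_strict_part ex_rules_defs\<close>)
  show "plit ''c'' \<in> Th \<Gamma>"
    by (rule Th_rule[where Ls = "[plit ''b'']"])
      (use assms b in \<open>auto simp: ex_strict_part ex_rules_defs\<close>)
qed

section \<open>Minimality of the three arguments\<close>

lemma ex_minimal_1: "(ex_A1, plit ''p'') \<in> minimal_arguments ex_spec"
proof -
  let ?\<Gamma> = "ex_A1 \<union> strict_part ex_spec"
  have "plit ''d'' \<in> Th ?\<Gamma>"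
    by (rule ex_strict_derivable) auto
  then have "plit ''a'' \<in> Th ?\<Gamma>"
    by (intro Th_rule[where Ls = "[plit ''d'']"]) (auto simp: ex_A1_def)
  then have "plit ''p'' \<in> Th ?\<Gamma>"
    by (intro Th_rule[where Ls = "[plit ''a'']"]) (auto simp: ex_A1_def)
  moreover have "plit ''p'' \<notin> Th (\<A> \<union> strict_part ex_spec)" if "\<A> \<subset> ex_A1" for \<A>
  proof -
    from that consider "\<A> \<subseteq> {Rule (plit ''a'') [plit ''d'']}"
      | "\<A> \<subseteq> {Rule (plit ''p'') [plit ''a'']}"
      unfolding ex_A1_def by blast
    then show ?thesis
    proof cases
      case 1
      then have "Th (\<A> \<union> strict_part ex_spec) \<subseteq> - {plit ''p''}"
        unfolding ex_strict_part
        by (intro Th_ground_subset) (auto simp: ex_rules_defs)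
      then show ?thesis by auto
    next
      case 2
      \<comment> \<open>Without \<open>d => a\<close> nothing yields \<open>a\<close>; it has to be
        omitted too for closure under \<open>a => p\<close>.\<close>
      then have "Th (\<A> \<union> strict_part ex_spec) \<subseteq> - {plit ''p'', plit ''a''}"
        unfolding ex_strict_part
        by (intro Th_ground_subset) (auto simp: ex_rules_defs)
      then show ?thesis by auto
    qed
  qed
  ultimately show ?thesis
    by (auto simp: minimal_arguments_def arguments_def ex_ground_instances)
qed

lemma ex_minimal_2: "(ex_A2, plit ''q'') \<in> minimal_arguments ex_spec"
proof -
  have "plit ''b'' \<in> Th (ex_A2 \<union> strict_part ex_spec)"
    by (rule ex_strict_derivable) auto
  then have "plit ''q'' \<in> Th (ex_A2 \<union> strict_part ex_spec)"
    by (intro Th_rule[where Ls = "[plit ''b'']"]) (auto simp: ex_A2_def)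
  moreover have "plit ''q'' \<notin> Th (\<A> \<union> strict_part ex_spec)" if "\<A> \<subset> ex_A2" for \<A>
  proof -
    from that have "\<A> = {}"
      by (auto simp: ex_A2_def)
    then show ?thesis
      using ex_Th_strict_part by auto
  qed
  ultimately show ?thesis
    by (auto simp: minimal_arguments_def arguments_def ex_ground_instances)
qed

lemma ex_minimal_3: "(ex_A3, plit ''r'') \<in> minimal_arguments ex_spec"
proof -
  have "plit ''c'' \<in> Th (ex_A3 \<union> strict_part ex_spec)"
    by (rule ex_strict_derivable) auto
  then have "plit ''r'' \<in> Th (ex_A3 \<union> strict_part ex_spec)"
    by (intro Th_rule[where Ls = "[plit ''c'']"]) (auto simp: ex_A3_def)
  moreover have "plit ''r'' \<notin> Th (\<A> \<union> strict_part ex_spec)" if "\<A> \<subset> ex_A3" for \<A>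
  proof -
    from that have "\<A> = {}"
      by (auto simp: ex_A3_def)
    then show ?thesis
      using ex_Th_strict_part by auto
  qed
  ultimately show ?thesis
    by (auto simp: minimal_arguments_def arguments_def ex_ground_instances)
qed

section \<open>Comparisons that hold\<close>

text \<open>If \<open>p\<close> is not in \<open>H\<close>, deriving it needs \<open>a\<close> or
  \<open>d\<close> in \<open>H\<close>. From \<open>a\<close> the general rule gives
  \<open>q\<close>; from \<open>d\<close> one gets \<open>b\<close>, and then \<open>q\<close> by
  \<open>ex_A2\<close>.\<close>

lemma ex_P2_le_12: "P2_le ex_spec (ex_A1, plit ''p'') (ex_A2, plit ''q'')"
  unfolding P2_le_def simplified_activation_set_def fst_conv snd_conv ex_general
proof (intro allI impI, elim conjE, rule ccontr)
  fix H
  assume H: "H \<subseteq> Th (strict_part ex_spec \<union> defeasible ex_spec)"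
    and p: "plit ''p'' \<in> Th (lit_rules H \<union> ex_A1 \<union> ex_general)"
    and not_p: "plit ''p'' \<notin> Th (lit_rules H \<union> {} \<union> ex_general)"
    and not_q: "plit ''q'' \<notin> Th (lit_rules H \<union> ex_A2 \<union> ex_general)"
  let ?\<Gamma> = "lit_rules H \<union> ex_A2 \<union> ex_general"
  have not_pH: "plit ''p'' \<notin> H"
    using not_p Th_rule[of "plit ''p''" "[]"] by (auto simp: lit_rules_def)
  have fact: "L \<in> Th ?\<Gamma>" if "L \<in> H" for L
    using that by (intro Th_rule[where Ls = "[]"]) (auto simp: lit_rules_def)
  have not_a: "plit ''a'' \<notin> Th ?\<Gamma>"
    using not_q Th_rule[of "plit ''q''" "[plit ''a'']" ?\<Gamma>] by (auto simp: ex_general_def)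
  have not_b: "plit ''b'' \<notin> Th ?\<Gamma>"
    using not_q Th_rule[of "plit ''q''" "[plit ''b'']" ?\<Gamma>] by (auto simp: ex_A2_def)
  have not_d: "plit ''d'' \<notin> Th ?\<Gamma>"
    using not_b Th_rule[of "plit ''b''" "[plit ''d'']" ?\<Gamma>] by (auto simp: ex_general_def)
  have "Th (lit_rules H \<union> ex_A1 \<union> ex_general)
          \<subseteq> - {plit ''p'', plit ''a'', plit ''b'', plit ''d''}"
    using H ex_Th_all not_pH not_a not_b not_d fact
    by (intro Th_ground_subset) (auto simp: ex_rules_defs)
  with p show False by auto
qed

text \<open>When \<open>q\<close> does not follow from \<open>H\<close> by general rules alone,
  neither \<open>q\<close> nor \<open>a\<close> is in \<open>H\<close>, so \<open>q\<close> must
  come through \<open>b\<close>. The general rules then lead from \<open>b\<close> to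
  \<open>c\<close>, and \<open>ex_A3\<close> gives \<open>r\<close>.\<close>

lemma ex_P2_le_23: "P2_le ex_spec (ex_A2, plit ''q'') (ex_A3, plit ''r'')"
  unfolding P2_le_def simplified_activation_set_def fst_conv snd_conv ex_general
proof (intro allI impI, elim conjE, rule ccontr)
  fix H
  assume H: "H \<subseteq> Th (strict_part ex_spec \<union> defeasible ex_spec)"
    and q: "plit ''q'' \<in> Th (lit_rules H \<union> ex_A2 \<union> ex_general)"
    and not_q: "plit ''q'' \<notin> Th (lit_rules H \<union> {} \<union> ex_general)"
    and not_r: "plit ''r'' \<notin> Th (lit_rules H \<union> ex_A3 \<union> ex_general)"
  let ?\<Gamma> = "lit_rules H \<union> ex_A3 \<union> ex_general"
  let ?\<Gamma>\<^sub>0 = "lit_rules H \<union> {} \<union> ex_general"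
  have fact: "L \<in> Th ?\<Gamma>" "L \<in> Th ?\<Gamma>\<^sub>0" if "L \<in> H" for L
    by (rule Th_rule[where Ls = "[]"]; use that in \<open>auto simp: lit_rules_def\<close>)+
  have not_a: "plit ''a'' \<notin> Th ?\<Gamma>\<^sub>0"
    using not_q Th_rule[of "plit ''q''" "[plit ''a'']" ?\<Gamma>\<^sub>0] by (auto simp: ex_general_def)
  have not_c: "plit ''c'' \<notin> Th ?\<Gamma>"
    using not_r Th_rule[of "plit ''r''" "[plit ''c'']" ?\<Gamma>] by (auto simp: ex_A3_def)
  have not_b: "plit ''b'' \<notin> Th ?\<Gamma>"
    using not_c Th_rule[of "plit ''c''" "[plit ''b'']" ?\<Gamma>] by (auto simp: ex_general_def)
  have not_d: "plit ''d'' \<notin> Th ?\<Gamma>"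
    using not_b Th_rule[of "plit ''b''" "[plit ''d'']" ?\<Gamma>] by (auto simp: ex_general_def)
  have not_H: "plit ''a'' \<notin> H" "plit ''b'' \<notin> H" "plit ''d'' \<notin> H" "plit ''q'' \<notin> H"
    using not_a not_b not_d not_q fact by blast+
  have "Th (lit_rules H \<union> ex_A2 \<union> ex_general)
          \<subseteq> - {plit ''q'', plit ''a'', plit ''b'', plit ''d''}"
    using H ex_Th_all not_H
    by (intro Th_ground_subset) (auto simp: ex_rules_defs)
  with q show False by auto
qed

section \<open>Comparisons that fail\<close>

text \<open>Makes the witnesses \<open>{a}\<close>, \<open>{b}\<close>, \<open>{c}\<close> below
  admissible choices of \<open>H\<close>.\<close>

lemma ex_derivable:
  "plit ` {''a'', ''b'', ''c'', ''d''} \<subseteq> Th (strict_part ex_spec \<union> defeasible ex_spec)"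
proof -
  let ?\<Gamma> = "strict_part ex_spec \<union> defeasible ex_spec"
  note bcd = ex_strict_derivable[of ?\<Gamma>, OF Un_upper1]
  have "plit ''a'' \<in> Th ?\<Gamma>"
    using bcd by (intro Th_rule[where Ls = "[plit ''d'']"]) (auto simp: ex_spec_def ex_A1_def)
  with bcd show ?thesis by auto
qed

lemma ex_not_P1_le_13: "\<not> P1_le ex_spec (ex_A1, plit ''p'') (ex_A3, plit ''r'')"
proof -
  let ?H = "{plit ''a''}"
  have "plit ''a'' \<in> Th (lit_rules ?H \<union> ex_A1 \<union> ex_general)"
    by (rule Th_rule[where Ls = "[]"]) (auto simp: lit_rules_def)
  then have "plit ''p'' \<in> Th (lit_rules ?H \<union> ex_A1 \<union> ex_general)"
    by (intro Th_rule[where Ls = "[plit ''a'']"]) (auto simp: ex_A1_def)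
  \<comment> \<open>Activation does not use the fact \<open>d\<close>, so the chain to
    \<open>c\<close> never starts. The bound excludes both \<open>p\<close>, as the side condition
    of P1 demands, and \<open>r\<close>.\<close>
  moreover have "Th (lit_rules ?H \<union> ex_A3 \<union> ex_general) \<subseteq> plit ` {''a'', ''q''}"
    by (rule Th_ground_subset) (auto simp: ex_rules_defs)
  ultimately show ?thesis
    using ex_derivable
    by (auto simp: P1_le_def simplified_activation_set_def intro!: exI[of _ ?H])
qed

lemma ex_not_P1_le_21: "\<not> P1_le ex_spec (ex_A2, plit ''q'') (ex_A1, plit ''p'')"
proof -
  let ?H = "{plit ''b''}"
  have "plit ''b'' \<in> Th (lit_rules ?H \<union> ex_A2 \<union> ex_general)"
    by (rule Th_rule[where Ls = "[]"]) (auto simp: lit_rules_def)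
  then have "plit ''q'' \<in> Th (lit_rules ?H \<union> ex_A2 \<union> ex_general)"
    by (intro Th_rule[where Ls = "[plit ''b'']"]) (auto simp: ex_A2_def)
  \<comment> \<open>Excludes \<open>q\<close> for the side condition and \<open>p\<close> for the
    conclusion.\<close>
  moreover have "Th (lit_rules ?H \<union> ex_A1 \<union> ex_general) \<subseteq> plit ` {''b'', ''c''}"
    by (rule Th_ground_subset) (auto simp: ex_rules_defs)
  ultimately show ?thesis
    using ex_derivable
    by (auto simp: P1_le_def simplified_activation_set_def intro!: exI[of _ ?H])
qed

lemma ex_not_P1_le_32: "\<not> P1_le ex_spec (ex_A3, plit ''r'') (ex_A2, plit ''q'')"
proof -
  let ?H = "{plit ''c''}"
  have "plit ''c'' \<in> Th (lit_rules ?H \<union> ex_A3 \<union> ex_general)"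
    by (rule Th_rule[where Ls = "[]"]) (auto simp: lit_rules_def)
  then have "plit ''r'' \<in> Th (lit_rules ?H \<union> ex_A3 \<union> ex_general)"
    by (intro Th_rule[where Ls = "[plit ''c'']"]) (auto simp: ex_A3_def)
  moreover have "Th (lit_rules ?H \<union> ex_A2 \<union> ex_general) \<subseteq> plit ` {''c''}"
    by (rule Th_ground_subset) (auto simp: ex_rules_defs)
  ultimately show ?thesis
    using ex_derivable
    by (auto simp: P1_le_def simplified_activation_set_def intro!: exI[of _ ?H])
qed

theorem theorem5p10:
  "\<exists>S :: (string, string, string) lp_spec.
     \<not> contradictory (lit_rules (facts S) \<union> general S \<union> defeasible S) \<and>
     (\<forall>R \<in> {P1_le S, P2_le S, P3_le S,
             strict_of (P1_le S), strict_of (P2_le S), strict_of (P3_le S)}.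
        \<not> transp_on (arguments S) R \<and>
        (\<exists>X\<^sub>1 \<in> minimal_arguments S. \<exists>X\<^sub>2 \<in> minimal_arguments S. \<exists>X\<^sub>3 \<in> minimal_arguments S.
           R X\<^sub>1 X\<^sub>2 \<and> R X\<^sub>2 X\<^sub>3 \<and> \<not> R X\<^sub>1 X\<^sub>3))"
proof (intro exI[of _ ex_spec] conjI ex_not_contradictory ballI)
  let ?X1 = "(ex_A1, plit ''p'')" and ?X2 = "(ex_A2, plit ''q'')" and ?X3 = "(ex_A3, plit ''r'')"
  fix R
  assume R: "R \<in> {P1_le ex_spec, P2_le ex_spec, P3_le ex_spec,
    strict_of (P1_le ex_spec), strict_of (P2_le ex_spec), strict_of (P3_le ex_spec)}"
  note P2 = ex_P2_le_12 ex_P2_le_23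
  note P1 = P2[THEN P2_le_imp_P1_le]
  have P3: "P3_le ex_spec ?X1 ?X2" "P3_le ex_spec ?X2 ?X3"
    using P2 ex_Th_strict_part by (auto simp: P3_le_def)
  note not_P1 = ex_not_P1_le_13 ex_not_P1_le_21 ex_not_P1_le_32
  \<comment> \<open>Failures pass from the weakest relation P1 to P2 and P3 by
    contraposition.\<close>
  have not_P2: "\<not> P2_le ex_spec ?X1 ?X3" "\<not> P2_le ex_spec ?X2 ?X1" "\<not> P2_le ex_spec ?X3 ?X2"
    by (use not_P1 P2_le_imp_P1_le in blast)+
  have not_P3: "\<not> P3_le ex_spec ?X1 ?X3" "\<not> P3_le ex_spec ?X2 ?X1" "\<not> P3_le ex_spec ?X3 ?X2"
    using not_P2 by (simp_all add: P3_le_def)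
  \<comment> \<open>The strict versions also use the two failing converses; their failure from
    \<open>?X1\<close> to \<open>?X3\<close> is that of the non-strict relation.\<close>
  have triple: "R ?X1 ?X2" "R ?X2 ?X3" "\<not> R ?X1 ?X3"
    using R by (auto simp: strict_of_def P1 P2 P3 not_P1 not_P2 not_P3)
  show "\<exists>X\<^sub>1 \<in> minimal_arguments ex_spec. \<exists>X\<^sub>2 \<in> minimal_arguments ex_spec.
      \<exists>X\<^sub>3 \<in> minimal_arguments ex_spec. R X\<^sub>1 X\<^sub>2 \<and> R X\<^sub>2 X\<^sub>3 \<and> \<not> R X\<^sub>1 X\<^sub>3"
    by (intro bexI conjI) (fact triple ex_minimal_1 ex_minimal_2 ex_minimal_3)+
  have "?X1 \<in> arguments ex_spec" "?X2 \<in> arguments ex_spec" "?X3 \<in> arguments ex_spec"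
    using ex_minimal_1 ex_minimal_2 ex_minimal_3 by (simp_all add: minimal_arguments_def)
  then show "\<not> transp_on (arguments ex_spec) R"
    using triple transp_onD[of "arguments ex_spec" R ?X1 ?X2 ?X3] by blast
qed

end
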